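(* Let $\mathbb{A}$ be a commutative ring, let $n\ge1$, and let $G$ be a finite group acting on an $\mathbb{A}$-weighted set $(X,f)$, where $n$ and $|G|$ are invertible in $\mathbb{A}$. Then $$|C^{orb}_{n}(X/^{orb}G)|_{f}=\frac{1}{n}\sum_{d\mid n}\ \sum_{\alpha:[\frac{n}{d}]\to P(G)}\frac{J_{2}(d)}{|G|^{\frac{n}{d}}}\prod_{i=1}^{n/d}|\pi_{C(G)}(\alpha(i))|\,|X^{\alpha(i)}|_{f^{d}},$$ where the inner sum runs over all maps $\alpha:[\frac nd]\to P(G)$.
   Context: An $\mathbb{A}$-weighted set is a pair $(X,f)$ with $X$ a finite set and $f:X\to\mathbb{A}$ any map; $|Y|_f=\sum_{x\in Y}f(x)$ for $Y\subseteq X$; $f^{d}$ is the pointwise power of $f$. A finite group $G$ acts on $(X,f)$ if $G$ acts on $X$ and $f(gx)=f(x)$ for all $g\in G$, $x\in X$. $[k]=\{1,\dots,k\}$. $C(G)$ is the set of conjugacy classes of $G$, with a fixed representative $g$ for each class $\overline{g}$, and $|\overline{g}|$ is the number of elements of the class; $Z(g)$ is the centralizer of $g$ in $G$; $P(G)=\{(\overline{g},h)\mid\overline{g}\in C(G),\ h\in Z(g)\}$. The map $\pi_{C(G)}:P(G)\to C(G)$ is $(\overline{g},h)\mapsto\overline{g}$. For $\alpha(i)=(\overline{g},h)$, $X^{\alpha(i)}=X^{\langle g,h\rangle}=\{x\in X\mid gx=x\text{ and }hx=x\}$. The orbiquotient of $X$ by $G$ is $X/^{orb}G=\bigsqcup_{\overline{g}\in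 C(G)}X^{g}/Z(g)$, with $X^g=\{x\in X\mid gx=x\}$; it is weighted by giving an orbit in $X^g/Z(g)$ the weight $f(x)$ of any of its elements $x$. For a weighted set $Y$, the set of orbi $n$-cycles is $C_n^{orb}(Y)=Y^{n}/^{orb}\mathbb{Z}_n$, where $\mathbb{Z}_n$ is the cyclic group of order $n$ acting on $Y^n$ by cyclically permuting (translating) coordinates, $Y^n$ has the product weight $(y_1,\dots,y_n)\mapsto\prod_i f(y_i)$, and the orbiquotient carries the induced weight. $|C_n^{orb}(Y)|_f$ is the sum of these weights. $J_2$ is the Jordan totient function $J_2(d)=|\{(x_1,x_2)\in\{1,\dots,d\}^2\mid\gcd(x_1,x_2,d)=1\}|$. *)

theory Defs
  imports "HOL-Algebra.Group_Action" "HOL-Algebra.Elementary_Groups"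
begin

definition conj_classes :: "('g, 'm) monoid_scheme \<Rightarrow> 'g set set" where
  "conj_classes G =
     orbits G (carrier G) (\<lambda>g. \<lambda>h\<in>carrier G. g \<otimes>\<^bsub>G\<^esub> h \<otimes>\<^bsub>G\<^esub> inv\<^bsub>G\<^esub> g)"

text \<open>A choice of one representative in every conjugacy class.\<close>

definition class_reps :: "('g, 'm) monoid_scheme \<Rightarrow> ('g set \<Rightarrow> 'g) \<Rightarrow> bool" where
  "class_reps G r \<longleftrightarrow> (\<forall>c\<in>conj_classes G. r c \<in> c)"

definition centralizer :: "('g, 'm) monoid_scheme \<Rightarrow> 'g \<Rightarrow> 'g set" where
  "centralizer G g = {h \<in> carrier G. h \<otimes>\<^bsub>G\<^esub> g = g \<otimes>\<^bsub>G\<^esub> h}"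

definition class_pairs :: "('g, 'm) monoid_scheme \<Rightarrow> ('g set \<Rightarrow> 'g) \<Rightarrow> ('g set \<times> 'g) set" where
  "class_pairs G r = (SIGMA c:conj_classes G. centralizer G (r c))"

text \<open>The disjoint union is tagged by the conjugacy class, so an element of the orbiquotient
  is a pair of a class and an orbit of the centralizer of its representative.\<close>

definition orbiquotient ::
  "('g, 'm) monoid_scheme \<Rightarrow> ('g set \<Rightarrow> 'g) \<Rightarrow> 'x set \<Rightarrow> ('g \<Rightarrow> 'x \<Rightarrow> 'x) \<Rightarrow> ('g set \<times> 'x set) set"
where
  "orbiquotient G r X \<phi> =
     (SIGMA c:conj_classes G. orbits (G\<lparr>carrier := centralizer G (r c)\<rparr>) (invariants X \<phi> (r c)) \<phi>)"

text \<open>For an invariant weight, the image of an orbit is a singleton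
  (see \<open>orbi_weight_eq\<close> below).\<close>

definition orbi_weight :: "('x \<Rightarrow> 'r) \<Rightarrow> 'c \<times> 'x set \<Rightarrow> 'r" where
  "orbi_weight f z = the_elem (f ` snd z)"

text \<open>The coordinates of an \<open>n\<close>-tuple are indexed by the elements of the cyclic group
  of order \<open>n\<close>. The library makes \<open>integer_mod_group 0\<close> infinite cyclic, so these notions are
  meant for positive \<open>n\<close> only.\<close>

definition tuples :: "nat \<Rightarrow> 'y set \<Rightarrow> (int \<Rightarrow> 'y) set" where
  "tuples n Y = (carrier (integer_mod_group n) \<rightarrow>\<^sub>E Y)"

definition tuple_weight :: "nat \<Rightarrow> ('y \<Rightarrow> 'r::comm_monoid_mult) \<Rightarrow> (int \<Rightarrow> 'y) \<Rightarrow> 'r" where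
  "tuple_weight n f y = (\<Prod>i\<in>carrier (integer_mod_group n). f (y i))"

definition translate :: "nat \<Rightarrow> 'y set \<Rightarrow> int \<Rightarrow> (int \<Rightarrow> 'y) \<Rightarrow> (int \<Rightarrow> 'y)" where
  "translate n Y k =
     (\<lambda>y\<in>tuples n Y. \<lambda>i\<in>carrier (integer_mod_group n). y (i \<otimes>\<^bsub>integer_mod_group n\<^esub> k))"

definition orbi_cycles ::
  "(int set \<Rightarrow> int) \<Rightarrow> nat \<Rightarrow> 'y set \<Rightarrow> (int set \<times> (int \<Rightarrow> 'y) set) set" where
  "orbi_cycles s n Y = orbiquotient (integer_mod_group n) s (tuples n Y) (translate n Y)"

definition jordan_totient2 :: "nat \<Rightarrow> nat" where
  "jordan_totient2 d = card {(x, y). x \<in> {1..d} \<and> y \<in> {1..d} \<and> gcd (gcd x y) d = 1}"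

text \<open>The inverse of a unit in a commutative ring; unspecified on non-units.\<close>

definition unit_inv :: "'r::comm_ring_1 \<Rightarrow> 'r" where
  "unit_inv a = (THE b. a * b = 1)"

lemma unit_inv_right:
  assumes "a dvd (1::'r::comm_ring_1)"
  shows "a * unit_inv a = 1"
proof -
  obtain b where b: "a * b = 1" using assms by (metis dvdE)
  have "c = b" if "a * c = 1" for c
    using that b by (metis mult.assoc mult.commute mult_1)
  with b have "unit_inv a = b" unfolding unit_inv_def by blast
  with b show ?thesis by simp
qed

lemma orbi_weight_eq:
  assumes "group_action G X \<phi>" "\<forall>g\<in>carrier G. \<forall>x\<in>X. f (\<phi> g x) = f x"
    and z: "z \<in> orbiquotient G r X \<phi>" and x: "x \<in> snd z"
  shows "orbi_weight f z = f x"
proof -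
  from z obtain a where a: "a \<in> X"
    "snd z = {\<phi> g a | g. g \<in> centralizer G (r (fst z))}"
    by (auto simp: orbiquotient_def orbits_def orbit_def invariants_def)
  have "f y = f a" if "y \<in> snd z" for y
    using that a assms(2) by (auto simp: centralizer_def)
  with x have "f ` snd z = {f x}" by fastforce
  then show ?thesis by (simp add: orbi_weight_def)
qed

lemma translate_group_action:
  assumes "n \<ge> 1"
  shows "group_action (integer_mod_group n) (tuples n Y) (translate n Y)"
proof -
  let ?Z = "carrier (integer_mod_group n)"
  have Z: "?Z = {0..<int n}" using assms by (simp add: carrier_integer_mod_group)
  have closed: "translate n Y k y \<in> tuples n Y" if "y \<in> tuples n Y" for k y
    using that assms by (auto simp: translate_def tuples_def Z PiE_iff)
  have comp: "translate n Y k (translate n Y l y) = translate n Y ((k + l) mod int n) y"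
    if "y \<in> tuples n Y" for k l y
    using that closed[OF that, of l] assms
    by (auto simp: translate_def Z mod_simps add.assoc fun_eq_iff)
  have zero: "translate n Y k y = y" if "y \<in> tuples n Y" "k mod int n = 0" for k y
  proof
    fix i
    have "(i + k) mod int n = i" if "i \<in> ?Z"
      using that \<open>k mod int n = 0\<close> Z by (metis add.right_neutral atLeastLessThan_iff mod_add_right_eq mod_pos_pos_trivial)
    then show "translate n Y k y i = y i"
      using \<open>y \<in> tuples n Y\<close> by (auto simp: translate_def tuples_def PiE_iff extensional_def)
  qed
  have bij: "translate n Y k \<in> Bij (tuples n Y)" for k
  proof -
    have inverse: "translate n Y k (translate n Y (- k) y) = y"
      "translate n Y (- k) (translate n Y k y) = y" if "y \<in> tuples n Y" for y
      using that by (simp_all add: comp zero)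
    have "bij_betw (translate n Y k) (tuples n Y) (tuples n Y)"
      by (rule bij_betw_byWitness[where f' = "translate n Y (- k)"]) (auto simp: inverse closed)
    then show ?thesis by (simp add: Bij_def translate_def)
  qed
  have "translate n Y \<in> hom (integer_mod_group n) (BijGroup (tuples n Y))"
  proof (rule homI)
    fix k l
    show "translate n Y (k \<otimes>\<^bsub>integer_mod_group n\<^esub> l)
        = translate n Y k \<otimes>\<^bsub>BijGroup (tuples n Y)\<^esub> translate n Y l"
    proof
      fix y
      show "translate n Y (k \<otimes>\<^bsub>integer_mod_group n\<^esub> l) y
          = (translate n Y k \<otimes>\<^bsub>BijGroup (tuples n Y)\<^esub> translate n Y l) y"
        by (cases "y \<in> tuples n Y")
           (simp_all add: BijGroup_def bij compose_def comp, simp add: translate_def)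
    qed
  qed (simp add: BijGroup_def bij)
  then show ?thesis
    by (simp add: group_action_def group_hom_def group_hom_axioms_def group_BijGroup)
qed

end

theory Submission
  imports Defs
begin

text \<open>
  Both sides of the identity come from counting orbits with weights, once for \<open>G\<close> and once for
  the cyclic group.

  For any finite group, Burnside's argument applied to the centralizer of each class representative
  \<open>g\<close> turns the weight of the orbits in \<open>X\<^sup>g/Z(g)\<close> into an average over the \<open>h\<close> that commute with
  \<open>g\<close>. Since \<open>|G| = |class of g| * |Z(g)|\<close>, the averages of the different classes have the common
  denominator \<open>|G|\<close>, and the weight of the orbiquotient becomes a sum over the pairs \<open>(g, h)\<close> in
  \<open>P(G)\<close> of the class size times the weight of the common fixed points, divided by \<open>|G|\<close>
  (\<open>orbiquotient_weight\<close>). This lemma is stated without division, so that it holds in every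
  commutative semiring; inverses enter only at the very end.

  Applied to the cyclic group acting on \<open>Y\<^sup>n\<close>, where all classes are singletons, it gives a sum over
  all pairs \<open>(k, l)\<close> of residues modulo \<open>n\<close>. A tuple is fixed by the translations by \<open>k\<close> and \<open>l\<close>
  iff it is periodic with period \<open>e = gcd(k, l, n)\<close>, so it is given by \<open>e\<close> free coordinates, each of
  them repeated \<open>n/e\<close> times (\<open>fixed_tuples_weight\<close>). Exactly \<open>J\<^sub>2(d)\<close> pairs have \<open>gcd(k, l, n) = n/d\<close>
  (\<open>sum_residue_pairs\<close>). Hence \<open>n\<close> times the weight of the orbicycles of \<open>Y\<close> is the sum over the
  divisors \<open>d\<close> of \<open>n\<close> of \<open>J\<^sub>2(d)\<close> times the \<open>n/d\<close>-th power of the sum of the \<open>d\<close>-th powers of the weights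
  of \<open>Y\<close> (\<open>orbi_cycles_weight\<close>).

  For \<open>Y\<close> the orbiquotient of \<open>X\<close>, that inner sum is the weight of the orbiquotient of \<open>(X, f\<^sup>d)\<close>,
  which is known from the first application. Expanding its \<open>n/d\<close>-th power by distributivity produces
  the sum over all maps \<open>\<alpha>\<close>.
\<close>

section \<open>Weighted orbit counting\<close>

text \<open>The point \<open>x\<close> contributes \<open>f x\<close> once for every element of its stabilizer, and the sizes of the
  stabilizers along an orbit add up to the order of the group. The statement allows a stable subset
  \<open>S\<close> of the set acted on, because \<open>group_action G E \<phi>\<close> demands that each \<open>\<phi> g\<close> is undefined
  outside \<open>E\<close>: the same \<open>\<phi>\<close> in general fails this on a proper subset such as the fixed points of
  an element.\<close>

lemma weighted_burnside:
  fixes f :: "'x \<Rightarrow> 'r::comm_semiring_1"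
  assumes act: "group_action G E \<phi>" and fin: "finite (carrier G)" "finite S"
    and S: "S \<subseteq> E" "\<And>g x. g \<in> carrier G \<Longrightarrow> x \<in> S \<Longrightarrow> \<phi> g x \<in> S"
    and f: "\<And>g x. g \<in> carrier G \<Longrightarrow> x \<in> S \<Longrightarrow> f (\<phi> g x) = f x"
  shows "of_nat (order G) * (\<Sum>U\<in>orbits G S \<phi>. the_elem (f ` U)) =
         (\<Sum>g\<in>carrier G. \<Sum>x\<in>invariants S \<phi> g. f x)"
proof -
  interpret group_action G E \<phi> by fact
  have sub: "orbits G S \<phi> \<subseteq> orbits G E \<phi>" using S(1) by (auto simp: orbits_def)
  have orbS: "orbit G \<phi> x \<subseteq> S" if "x \<in> S" for x
    using S(2) that by (auto simp: orbit_def)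
  have un: "\<Union> (orbits G S \<phi>) = S"
    using orbS orbit_refl S(1) by (fastforce simp: orbits_def)
  have const: "the_elem (f ` U) = f x" if "U \<in> orbits G S \<phi>" "x \<in> U" for U x
  proof -
    obtain a where a: "a \<in> S" "U = orbit G \<phi> a"
      using \<open>U \<in> orbits G S \<phi>\<close> by (auto simp: orbits_def)
    then have "f y = f a" if "y \<in> U" for y using that f by (auto simp: orbit_def)
    with \<open>x \<in> U\<close> have "f ` U = {f x}" by fastforce
    then show ?thesis by simp
  qed
  have stab: "(\<Sum>g\<in>carrier G. if x \<in> invariants S \<phi> g then f x else 0)
      = of_nat (card (stabilizer G \<phi> x)) * f x" if "x \<in> S" for x
  proof -
    have "(\<Sum>g\<in>carrier G. if x \<in> invariants S \<phi> g then f x else 0)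
       = (\<Sum>g\<in>stabilizer G \<phi> x. f x)"
      using that fin(1) by (intro sum.mono_neutral_cong_right)
        (auto simp: stabilizer_def invariants_def)
    then show ?thesis by simp
  qed
  have "(\<Sum>g\<in>carrier G. \<Sum>x\<in>invariants S \<phi> g. f x)
      = (\<Sum>g\<in>carrier G. \<Sum>x\<in>S. if x \<in> invariants S \<phi> g then f x else 0)"
    using fin(2) by (intro sum.cong refl sum.mono_neutral_cong_left) (auto simp: invariants_def)
  also have "\<dots> = (\<Sum>x\<in>S. \<Sum>g\<in>carrier G. if x \<in> invariants S \<phi> g then f x else 0)"
    by (rule sum.swap)
  also have "\<dots> = (\<Sum>x\<in>S. of_nat (card (stabilizer G \<phi> x)) * f x)"
    by (intro sum.cong refl stab)
  also have "\<dots> = (\<Sum>x\<in>\<Union> (orbits G S \<phi>). of_nat (card (stabilizer G \<phi> x)) * f x)"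
    by (simp only: un)
  also have "\<dots> = (\<Sum>U\<in>orbits G S \<phi>. \<Sum>x\<in>U. of_nat (card (stabilizer G \<phi> x)) * f x)"
  proof (subst sum.Union_disjoint)
    show "\<forall>A\<in>orbits G S \<phi>. finite A"
      using orbS fin(2) by (auto simp: orbits_def intro: finite_subset)
    show "\<forall>A\<in>orbits G S \<phi>. \<forall>B\<in>orbits G S \<phi>. A \<noteq> B \<longrightarrow> A \<inter> B = {}"
      using disjoint_union sub by blast
  qed simp
  also have "\<dots> = (\<Sum>U\<in>orbits G S \<phi>. of_nat (\<Sum>x\<in>U. card (stabilizer G \<phi> x)) * the_elem (f ` U))"
    by (intro sum.cong refl) (simp add: const sum_distrib_right)
  also have "\<dots> = (\<Sum>U\<in>orbits G S \<phi>. of_nat (order G) * the_elem (f ` U))"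
    using sub by (intro sum.cong refl) (simp only: card_stablizer_sum[OF fin(1)] subsetD)
  finally show ?thesis by (simp add: sum_distrib_left)
qed

section \<open>The orbiquotient\<close>

lemma class_rep_in_carrier:
  assumes "group G" "class_reps G r" "c \<in> conj_classes G"
  shows "r c \<in> carrier G"
proof -
  interpret group G by fact
  have "\<Union> (conj_classes G) = carrier G"
    unfolding conj_classes_def
    by (rule group_action.orbits_coverture[OF action_by_conjugation])
  then show ?thesis using assms(2,3) by (auto simp: class_reps_def)
qed

lemma finite_conj_classes:
  assumes "finite (carrier G)"
  shows "finite (conj_classes G)"
  using assms by (simp add: conj_classes_def orbits_def)

lemma finite_centralizer:
  assumes "finite (carrier G)"
  shows "finite (centralizer G g)"
  using assms by (simp add: centralizer_def)

lemma centralizer_as_stabilizer: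
  assumes "group G" "g \<in> carrier G"
  shows "centralizer G g =
         stabilizer G (\<lambda>g. \<lambda>h\<in>carrier G. g \<otimes>\<^bsub>G\<^esub> h \<otimes>\<^bsub>G\<^esub> inv\<^bsub>G\<^esub> g) g"
proof -
  interpret group G by fact
  have "h \<otimes>\<^bsub>G\<^esub> g \<otimes>\<^bsub>G\<^esub> inv\<^bsub>G\<^esub> h = g \<longleftrightarrow> h \<otimes>\<^bsub>G\<^esub> g = g \<otimes>\<^bsub>G\<^esub> h" if "h \<in> carrier G" for h
    using that assms(2) by (metis inv_solve_right m_closed)
  then show ?thesis using assms(2) by (auto simp: centralizer_def stabilizer_def)
qed

lemma subgroup_centralizer:
  assumes "group G" "g \<in> carrier G"
  shows "subgroup (centralizer G g) G"
  using centralizer_as_stabilizer[OF assms]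
    group_action.stabilizer_subgroup[OF group.action_by_conjugation[OF assms(1)] assms(2)]
  by simp

lemma card_class_times_centralizer:
  assumes "group G" "class_reps G r" "c \<in> conj_classes G"
  shows "card c * card (centralizer G (r c)) = order G"
proof -
  let ?\<gamma> = "\<lambda>g. \<lambda>h\<in>carrier G. g \<otimes>\<^bsub>G\<^esub> h \<otimes>\<^bsub>G\<^esub> inv\<^bsub>G\<^esub> g"
  interpret conj: group_action G "carrier G" ?\<gamma>
    by (rule group.action_by_conjugation[OF assms(1)])
  have rc: "r c \<in> carrier G" by (rule class_rep_in_carrier[OF assms])
  have "r c \<in> c" using assms by (simp add: class_reps_def)
  moreover have "orbit G ?\<gamma> (r c) \<in> conj_classes G"
    using rc by (auto simp: conj_classes_def orbits_def)
  ultimately have "orbit G ?\<gamma> (r c) = c"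
    using conj.disjoint_union[of c "orbit G ?\<gamma> (r c)"] assms(3) conj.orbit_refl[OF rc]
    unfolding conj_classes_def by blast
  then show ?thesis
    using conj.orbit_stabilizer_theorem[OF rc] centralizer_as_stabilizer[OF assms(1) rc] by simp
qed

text \<open>The centralizer of \<open>r c\<close> preserves the fixed points of \<open>r c\<close>, so Burnside's count applies to it
  there. It carries the factor \<open>|Z(r c)|\<close>; multiplying by the size of \<open>c\<close> raises this to \<open>|G|\<close>, the
  same factor for every class.\<close>

lemma orbiquotient_weight:
  fixes f :: "'x \<Rightarrow> 'r::comm_semiring_1"
  assumes act: "group_action G X \<phi>" and fin: "finite (carrier G)" "finite X"
    and f: "\<forall>g\<in>carrier G. \<forall>x\<in>X. f (\<phi> g x) = f x"
    and r: "class_reps G r"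
  shows "of_nat (order G) * (\<Sum>z\<in>orbiquotient G r X \<phi>. orbi_weight f z) =
         (\<Sum>p\<in>class_pairs G r. of_nat (card (fst p)) *
            (\<Sum>x\<in>invariants X \<phi> (r (fst p)) \<inter> invariants X \<phi> (snd p). f x))"
proof -
  interpret group_action G X \<phi> by fact
  have G: "group G" using group_hom group_hom.axioms(1) by blast
  define Q where "Q = (\<lambda>c. orbits (G\<lparr>carrier := centralizer G (r c)\<rparr>) (invariants X \<phi> (r c)) \<phi>)"
  have fin_inv: "finite (invariants X \<phi> g)" for g using fin(2) by (simp add: invariants_def)
  have finQ: "finite (Q c)" for c using fin_inv by (simp add: Q_def orbits_def)
  have fin_cl: "finite (conj_classes G)" by (rule finite_conj_classes[OF fin(1)])
  have cl: "of_nat (order G) * (\<Sum>U\<in>Q c. the_elem (f ` U)) =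
      (\<Sum>h\<in>centralizer G (r c). of_nat (card c) *
         (\<Sum>x\<in>invariants X \<phi> (r c) \<inter> invariants X \<phi> h. f x))"
    if c: "c \<in> conj_classes G" for c
  proof -
    let ?Z = "centralizer G (r c)" and ?S = "invariants X \<phi> (r c)"
    have rc: "r c \<in> carrier G" by (rule class_rep_in_carrier[OF G r c])
    have ZG: "?Z \<subseteq> carrier G" by (auto simp: centralizer_def)
    have stable: "\<phi> h x \<in> ?S" if "h \<in> ?Z" "x \<in> ?S" for h x
    proof -
      have h: "h \<in> carrier G" "h \<otimes>\<^bsub>G\<^esub> r c = r c \<otimes>\<^bsub>G\<^esub> h"
        and x: "x \<in> X" "\<phi> (r c) x = x"
        using that by (auto simp: centralizer_def invariants_def)
      then have "\<phi> (r c) (\<phi> h x) = \<phi> h x"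
        using composition_rule[of x "r c" h] composition_rule[of x h "r c"] rc by simp
      then show ?thesis using element_image[OF h(1) x(1) refl] by (simp add: invariants_def)
    qed
    let ?GZ = "G\<lparr>carrier := ?Z\<rparr>"
    have "of_nat (order ?GZ) * (\<Sum>U\<in>Q c. the_elem (f ` U)) =
        (\<Sum>h\<in>carrier ?GZ. \<Sum>x\<in>invariants ?S \<phi> h. f x)"
      unfolding Q_def
    proof (rule weighted_burnside[OF induced_action[OF subgroup_centralizer[OF G rc]]])
      show "f (\<phi> h x) = f x" if "h \<in> carrier ?GZ" "x \<in> ?S" for h x
        using that f ZG by (auto simp: invariants_def)
    qed (use stable finite_centralizer[OF fin(1)] fin_inv in \<open>auto simp: invariants_def\<close>)
    then have "of_nat (card ?Z) * (\<Sum>U\<in>Q c. the_elem (f ` U)) =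
        (\<Sum>h\<in>?Z. \<Sum>x\<in>invariants ?S \<phi> h. f x)"
      by (simp add: order_def)
    moreover have "invariants ?S \<phi> h = ?S \<inter> invariants X \<phi> h" for h
      by (auto simp: invariants_def)
    ultimately have "of_nat (card c * card ?Z) * (\<Sum>U\<in>Q c. the_elem (f ` U)) =
        of_nat (card c) * (\<Sum>h\<in>?Z. \<Sum>x\<in>?S \<inter> invariants X \<phi> h. f x)"
      by (simp add: mult.assoc)
    then show ?thesis
      by (simp only: card_class_times_centralizer[OF G r c] sum_distrib_left)
  qed
  have "(\<Sum>z\<in>orbiquotient G r X \<phi>. orbi_weight f z) = (\<Sum>c\<in>conj_classes G. \<Sum>U\<in>Q c. the_elem (f ` U))"
    using fin_cl finQ
    by (simp add: orbiquotient_def Q_def[symmetric] orbi_weight_def sum.Sigma case_prod_beta)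
  then have "of_nat (order G) * (\<Sum>z\<in>orbiquotient G r X \<phi>. orbi_weight f z) =
      (\<Sum>c\<in>conj_classes G. of_nat (order G) * (\<Sum>U\<in>Q c. the_elem (f ` U)))"
    by (simp add: sum_distrib_left)
  also have "\<dots> = (\<Sum>c\<in>conj_classes G. \<Sum>h\<in>centralizer G (r c). of_nat (card c) *
         (\<Sum>x\<in>invariants X \<phi> (r c) \<inter> invariants X \<phi> h. f x))"
    by (intro sum.cong refl cl)
  finally show ?thesis
    using fin_cl finite_centralizer[OF fin(1)]
    by (simp add: class_pairs_def sum.Sigma case_prod_beta)
qed

lemma finite_orbiquotient:
  assumes "finite (carrier G)" "finite X"
  shows "finite (orbiquotient G r X \<phi>)"
  using assms by (auto simp: orbiquotient_def orbits_def invariants_def finite_conj_classes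
    intro!: finite_SigmaI)

text \<open>Powers of the weights on the orbiquotient are again weights on it, so sums of such powers are
  within the scope of \<open>orbiquotient_weight\<close>.\<close>

lemma orbi_weight_power:
  assumes act: "group_action G X \<phi>" and f: "\<forall>g\<in>carrier G. \<forall>x\<in>X. f (\<phi> g x) = f x"
    and r: "class_reps G r" and z: "z \<in> orbiquotient G r X \<phi>"
  shows "orbi_weight (\<lambda>x. f x ^ d) z = orbi_weight f z ^ d"
proof -
  interpret group_action G X \<phi> by fact
  have G: "group G" using group_hom group_hom.axioms(1) by blast
  have "fst z \<in> conj_classes G" using z by (auto simp: orbiquotient_def)
  then have "centralizer G (r (fst z)) \<noteq> {}"
    using subgroup.one_closed[OF subgroup_centralizer[OF G class_rep_in_carrier[OF G r]]]
    by blast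
  with z obtain x where x: "x \<in> snd z"
    by (fastforce simp: orbiquotient_def orbits_def orbit_def)
  show ?thesis
    using orbi_weight_eq[OF act f z x] orbi_weight_eq[OF act _ z x, of "\<lambda>x. f x ^ d"] f by simp
qed

section \<open>Tuples fixed by two translations\<close>

lemma periodic_multiple:
  fixes h :: "int \<Rightarrow> 'y"
  assumes "\<And>i. h (i + a) = h i"
  shows "h (i + u * a) = h i"
proof -
  have pos: "h (i + int m * a) = h i" for m i
  proof (induction m)
    case (Suc m)
    have "h (i + int (Suc m) * a) = h ((i + int m * a) + a)" by (simp add: algebra_simps)
    with Suc show ?case by (simp only: assms)
  qed simp
  show ?thesis
  proof (cases "u \<ge> 0")
    case True
    then show ?thesis using pos[of i "nat u"] by simp
  next
    case False
    then show ?thesis using pos[of "i + u * a" "nat (- u)"] by (simp add: algebra_simps)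
  qed
qed

text \<open>The periods of a function form a subgroup of the integers, so Bezout's identity applies.\<close>

lemma periodic_gcd:
  fixes h :: "int \<Rightarrow> 'y"
  assumes a: "\<And>i. h (i + a) = h i" and b: "\<And>i. h (i + b) = h i"
  shows "h (i + gcd a b) = h i"
proof -
  obtain u v where uv: "u * a + v * b = gcd a b" using bezout_int by blast
  have "h (i + gcd a b) = h ((i + u * a) + v * b)" by (simp add: uv[symmetric] add.assoc)
  then show ?thesis by (simp add: periodic_multiple[of h, OF a] periodic_multiple[of h, OF b])
qed

text \<open>Reducing the index modulo \<open>n\<close> extends a tuple to a function on all integers with period \<open>n\<close>; being
  fixed by a translation means that this extension has a further period.\<close>

lemma translate_fixed_iff:
  assumes n: "n \<ge> 1" and y: "y \<in> tuples n Y"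
  shows "translate n Y k y = y \<longleftrightarrow> (\<forall>i. y ((i + k) mod int n) = y (i mod int n))"
proof -
  have C: "carrier (integer_mod_group n) = {0..<int n}"
    using n by (simp add: carrier_integer_mod_group)
  have "translate n Y k y = y \<longleftrightarrow> (\<forall>i\<in>{0..<int n}. y ((i + k) mod int n) = y i)"
    using y by (auto simp: translate_def tuples_def C fun_eq_iff PiE_def extensional_def)
  also have "\<dots> \<longleftrightarrow> (\<forall>i. y ((i + k) mod int n) = y (i mod int n))"
  proof
    assume *: "\<forall>i\<in>{0..<int n}. y ((i + k) mod int n) = y i"
    show "\<forall>i. y ((i + k) mod int n) = y (i mod int n)"
    proof
      fix i
      show "y ((i + k) mod int n) = y (i mod int n)"
        using *[rule_format, of "i mod int n"] n by (simp add: mod_simps)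
    qed
  next
    assume *: "\<forall>i. y ((i + k) mod int n) = y (i mod int n)"
    show "\<forall>i\<in>{0..<int n}. y ((i + k) mod int n) = y i"
      using * by (metis atLeastLessThan_iff mod_pos_pos_trivial)
  qed
  finally show ?thesis .
qed

text \<open>The periodic extension of \<open>y\<close> has the periods \<open>k\<close>, \<open>l\<close> and \<open>n\<close>, hence their gcd. As the gcd
  divides \<open>n\<close>, this periodicity can be expressed by indices in the range from \<open>0\<close> to \<open>n - 1\<close> only.\<close>

lemma fixed_by_both_iff:
  assumes n: "n \<ge> 1" and y: "y \<in> tuples n Y"
  shows "translate n Y k y = y \<and> translate n Y l y = y \<longleftrightarrow>
         (\<forall>i\<in>{0..<int n}. y i = y (i mod gcd (gcd k l) (int n)))"
    (is "?L \<longleftrightarrow> ?R")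
proof
  let ?e = "gcd (gcd k l) (int n)"
  assume ?L
  define h where "h = (\<lambda>i. y (i mod int n))"
  have k: "h (i + k) = h i" and l: "h (i + l) = h i" for i
    using \<open>?L\<close> translate_fixed_iff[OF n y] by (simp_all add: h_def)
  have e: "h (i + ?e) = h i" for i
    by (rule periodic_gcd[of h, OF periodic_gcd[of h, OF k l]]) (simp add: h_def)
  show ?R
  proof
    fix i assume i: "i \<in> {0..<int n}"
    have "?e > 0" "?e \<le> int n" using n by (auto intro: zdvd_imp_le)
    then have "i mod ?e \<in> {0..<int n}"
      using pos_mod_bound[of ?e i] pos_mod_sign[of ?e i] by (auto simp del: pos_mod_bound)
    moreover have "h (i mod ?e) = h i"
      using periodic_multiple[of h, OF e, of "i mod ?e" "i div ?e"]
      by (simp only: mod_div_mult_eq)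
    ultimately show "y i = y (i mod ?e)" using i by (simp add: h_def)
  qed
next
  let ?e = "gcd (gcd k l) (int n)"
  assume R: ?R
  have red: "y (i mod int n) = y (i mod ?e)" for i
    using bspec[OF R, of "i mod int n"] n by (simp add: mod_mod_cancel)
  have "y ((i + m) mod int n) = y (i mod int n)" if "?e dvd m" for i m
  proof -
    obtain q where "m = ?e * q" using \<open>?e dvd m\<close> by (rule dvdE)
    then have "(i + m) mod ?e = i mod ?e" by (simp only: mod_mult_self2)
    then show ?thesis by (simp add: red)
  qed
  moreover have "?e dvd k" "?e dvd l" by (meson gcd_dvd1 gcd_dvd2 dvd_trans)+
  ultimately show ?L by (simp add: translate_fixed_iff[OF n y])
qed

lemma card_residue_class:
  assumes "e > 0" "e dvd n" "j \<in> {0..<int e}"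
  shows "card {i \<in> {0..<int n}. i mod int e = j} = n div e"
proof -
  have ne: "int n = int e * int (n div e)" using assms(2) by (metis dvd_mult_div_cancel of_nat_mult)
  have "bij_betw (\<lambda>t. j + int e * t) {0..<int (n div e)} {i \<in> {0..<int n}. i mod int e = j}"
  proof (rule bij_betw_byWitness[where f' = "\<lambda>i. i div int e"])
    show "(\<lambda>t. j + int e * t) ` {0..<int (n div e)} \<subseteq> {i \<in> {0..<int n}. i mod int e = j}"
    proof (rule image_subsetI)
      fix t assume "t \<in> {0..<int (n div e)}"
      then have t: "0 \<le> t" "t < int (n div e)" by auto
      have "int e * (t + 1) \<le> int e * int (n div e)" using t by (intro mult_left_mono) auto
      then show "j + int e * t \<in> {i \<in> {0..<int n}. i mod int e = j}"
        using assms(3) t ne by (auto simp: algebra_simps)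
    qed
    show "(\<lambda>i. i div int e) ` {i \<in> {0..<int n}. i mod int e = j} \<subseteq> {0..<int (n div e)}"
    proof (rule image_subsetI)
      fix i assume "i \<in> {i \<in> {0..<int n}. i mod int e = j}"
      then have i: "0 \<le> i" "i < int n" by auto
      have "int e * (i div int e) \<le> i"
        using mult_div_mod_eq[of "int e" i] pos_mod_sign[of "int e" i] assms(1) by linarith
      then have "int e * (i div int e) < int e * int (n div e)" using i ne by linarith
      then show "i div int e \<in> {0..<int (n div e)}"
        using i assms(1) by (auto simp: pos_imp_zdiv_nonneg_iff)
    qed
  qed (use assms in auto)
  then show ?thesis using bij_betw_same_card by fastforce
qed

lemma prod_residues:
  fixes F :: "int \<Rightarrow> 'r::comm_monoid_mult"
  assumes e: "e > 0" "e dvd n"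
  shows "(\<Prod>i\<in>{0..<int n}. F (i mod int e)) = (\<Prod>j\<in>{0..<int e}. F j ^ (n div e))"
proof -
  have "(\<Prod>i\<in>{0..<int n}. F (i mod int e))
      = (\<Prod>j\<in>{0..<int e}. \<Prod>i\<in>{i \<in> {0..<int n}. i mod int e = j}. F (i mod int e))"
    using e by (intro prod.group[symmetric]) auto
  also have "\<dots> = (\<Prod>j\<in>{0..<int e}. \<Prod>i\<in>{i \<in> {0..<int n}. i mod int e = j}. F j)"
    by (intro prod.cong refl) auto
  also have "\<dots> = (\<Prod>j\<in>{0..<int e}. F j ^ (n div e))"
    by (intro prod.cong refl) (simp only: prod_constant card_residue_class[OF e])
  finally show ?thesis .
qed

text \<open>A fixed tuple is determined by its first \<open>e\<close> coordinates, which are arbitrary. Each occurs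
  \<open>n div e\<close> times and so contributes its weight to that power; distributivity turns the sum over
  the tuples into a product of \<open>e\<close> equal sums.\<close>

lemma fixed_tuples_weight:
  fixes w :: "'y \<Rightarrow> 'r::comm_semiring_1" and k l :: int and n :: nat
  defines "e \<equiv> nat (gcd (gcd k l) (int n))"
  assumes n: "n \<ge> 1" and Y: "finite Y"
  shows "(\<Sum>y\<in>invariants (tuples n Y) (translate n Y) k \<inter> invariants (tuples n Y) (translate n Y) l.
            tuple_weight n w y) = (\<Sum>y\<in>Y. w y ^ (n div e)) ^ e"
proof -
  have int_e: "gcd (gcd k l) (int n) = int e" by (simp add: e_def)
  have e: "e > 0" "e dvd n"
  proof -
    show "e > 0" using n by (simp add: e_def)
    have "int e dvd int n" by (simp flip: int_e)
    then show "e dvd n" by simp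
  qed
  have le: "int e \<le> int n" using e n by (simp add: dvd_imp_le)
  have C: "carrier (integer_mod_group n) = {0..<int n}"
    using n by (simp add: carrier_integer_mod_group)
  let ?P = "{0..<int e} \<rightarrow>\<^sub>E Y"
  let ?ext = "\<lambda>z. \<lambda>i\<in>{0..<int n}. z (i mod int e)"
  let ?I = "invariants (tuples n Y) (translate n Y) k \<inter> invariants (tuples n Y) (translate n Y) l"
  have I: "?I = {y \<in> tuples n Y. \<forall>i\<in>{0..<int n}. y i = y (i mod int e)}"
    using fixed_by_both_iff[OF n, of _ Y k l, unfolded int_e] unfolding invariants_def by blast
  have bij: "bij_betw ?ext ?P ?I"
  proof (rule bij_betw_byWitness[where f' = "\<lambda>y. restrict y {0..<int e}"])
    show "\<forall>z\<in>?P. restrict (?ext z) {0..<int e} = z"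
      using le by (auto simp: fun_eq_iff PiE_def extensional_def)
    show "\<forall>y\<in>?I. ?ext (restrict y {0..<int e}) = y"
    proof (intro ballI ext)
      fix y i assume y: "y \<in> ?I"
      then have "y (i mod int e) = y i" if "i \<in> {0..<int n}" using that unfolding I by force
      then show "?ext (restrict y {0..<int e}) i = y i"
        using y e by (auto simp: invariants_def tuples_def C PiE_def extensional_def)
    qed
    have small: "i mod int e < int n" for i
      using le e pos_mod_bound[of "int e" i] by linarith
    show "?ext ` ?P \<subseteq> ?I"
      unfolding I using e small by (auto simp: tuples_def C PiE_iff)
    show "(\<lambda>y. restrict y {0..<int e}) ` ?I \<subseteq> ?P"
    proof (rule image_subsetI)
      fix y assume "y \<in> ?I"
      then show "restrict y {0..<int e} \<in> ?P"
        using le by (auto simp: invariants_def tuples_def C PiE_iff)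
    qed
  qed
  have "(\<Sum>y\<in>?I. tuple_weight n w y) = (\<Sum>z\<in>?P. tuple_weight n w (?ext z))"
    by (rule sum.reindex_bij_betw[OF bij, symmetric])
  also have "\<dots> = (\<Sum>z\<in>?P. \<Prod>j\<in>{0..<int e}. w (z j) ^ (n div e))"
  proof (intro sum.cong refl)
    fix z
    have "tuple_weight n w (?ext z) = (\<Prod>i\<in>{0..<int n}. w (z (i mod int e)))"
      by (simp add: tuple_weight_def C)
    then show "tuple_weight n w (?ext z) = (\<Prod>j\<in>{0..<int e}. w (z j) ^ (n div e))"
      using prod_residues[OF e, of "\<lambda>j. w (z j)"] by simp
  qed
  also have "\<dots> = (\<Prod>j\<in>{0..<int e}. \<Sum>y\<in>Y. w y ^ (n div e))"
    using Y by (intro prod_sum_PiE[symmetric]) auto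
  finally show ?thesis by simp
qed

section \<open>Counting pairs of translations\<close>

text \<open>Replacing the residue \<open>0\<close> by \<open>n\<close> changes no gcd with \<open>n\<close>. Then the pairs in
  \<open>{1..n} \<times> {1..n}\<close> whose gcd with \<open>n\<close> is \<open>e = n div d\<close> are the multiples by \<open>e\<close> of the pairs in
  \<open>{1..d} \<times> {1..d}\<close> whose gcd with \<open>d\<close> is \<open>1\<close>, and \<open>jordan_totient2 d\<close> counts these.\<close>

lemma sum_residue_pairs:
  fixes H :: "nat \<Rightarrow> 'r::comm_semiring_1"
  assumes n: "n \<ge> 1"
  shows "(\<Sum>k\<in>{0..<int n}. \<Sum>l\<in>{0..<int n}. H (nat (gcd (gcd k l) (int n)))) =
         (\<Sum>d | d dvd n. of_nat (jordan_totient2 d) * H (n div d))"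
proof -
  have shift: "(\<Sum>k\<in>{0..<int n}. F k) = (\<Sum>k\<in>{1..n}. F (int k mod int n))" for F :: "int \<Rightarrow> 'r"
  proof -
    have "bij_betw (\<lambda>k. int k mod int n) {1..n} {0..<int n}"
      by (rule bij_betw_byWitness[where f' = "\<lambda>i. if i = 0 then n else nat i"])
        (use n in \<open>auto simp: le_less mod_pos_pos_trivial nat_dvd_not_less split: if_splits\<close>)
    then show ?thesis by (metis (no_types, lifting) sum.cong sum.reindex_bij_betw)
  qed
  have gcd_mod: "nat (gcd (gcd (int a mod int n) (int b mod int n)) (int n)) = gcd (gcd a b) n" for a b
  proof -
    have "gcd (gcd (int a mod int n) (int b mod int n)) (int n) = gcd (gcd (int a) (int b)) (int n)"
      by (metis gcd.assoc gcd.commute gcd_red_int)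
    then show ?thesis by simp
  qed
  have count: "card {p \<in> {1..n} \<times> {1..n}. n div gcd (gcd (fst p) (snd p)) n = d} = jordan_totient2 d"
    if d: "d dvd n" for d
  proof -
    define e where "e = n div d"
    have e: "n = e * d" "d > 0" "e > 0" using d n by (auto simp: e_def intro!: Nat.gr0I)
    have quot: "n div gcd (gcd a b) n = d \<longleftrightarrow> gcd (gcd a b) n = e" for a b
    proof
      assume "n div gcd (gcd a b) n = d"
      then have "gcd (gcd a b) n * d = n" using dvd_mult_div_cancel[OF gcd_dvd2] by blast
      then show "gcd (gcd a b) n = e" using e by (metis mult_right_cancel not_gr_zero)
    next
      assume "gcd (gcd a b) n = e"
      then show "n div gcd (gcd a b) n = d" using e by simp
    qed
    have scale: "gcd (gcd (e * x) (e * y)) n = e * gcd (gcd x y) d" for x y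
      by (simp only: e(1) gcd_mult_distrib_nat)
    have le_n: "e * x \<le> n \<longleftrightarrow> x \<le> d" for x using e by simp
    let ?S = "{(x, y). x \<in> {1..d} \<and> y \<in> {1..d} \<and> gcd (gcd x y) d = 1}"
    let ?T = "{p \<in> {1..n} \<times> {1..n}. n div gcd (gcd (fst p) (snd p)) n = d}"
    have "(\<lambda>(x, y). (e * x, e * y)) ` ?S = ?T"
    proof (intro subset_antisym subsetI)
      fix p assume "p \<in> (\<lambda>(x, y). (e * x, e * y)) ` ?S"
      then show "p \<in> ?T" using e(2,3) le_n by (auto simp: quot scale)
    next
      fix p assume p: "p \<in> ?T"
      obtain a b where ab: "p = (a, b)" by (cases p)
      with p have *: "a \<in> {1..n}" "b \<in> {1..n}" "gcd (gcd a b) n = e"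
        by (simp_all only: mem_Collect_eq quot mem_Times_iff fst_conv snd_conv)
      then have "e dvd a" "e dvd b"
        using dvd_trans[OF gcd_dvd1 gcd_dvd1, of a b n] dvd_trans[OF gcd_dvd1 gcd_dvd2, of a b n]
        by (simp_all only:)
      then obtain x y where xy: "a = e * x" "b = e * y" by (meson dvdE)
      then have "e * gcd (gcd x y) d = e" using *(3) by (simp only: scale)
      then have "gcd (gcd x y) d = 1" using e(3) by simp
      moreover have "x \<in> {1..d}" "y \<in> {1..d}"
        using *(1,2) unfolding xy by (simp_all only: atLeastAtMost_iff le_n) (simp_all add: Suc_le_eq)
      ultimately have "(x, y) \<in> ?S" by simp
      then show "p \<in> (\<lambda>(x, y). (e * x, e * y)) ` ?S"
        by (rule image_eqI[rotated]) (simp add: ab xy)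
    qed
    moreover have "inj_on (\<lambda>(x, y). (e * x, e * y)) ?S" using e(3) by (auto simp: inj_on_def)
    ultimately have "bij_betw (\<lambda>(x, y). (e * x, e * y)) ?S ?T" by (rule bij_betw_imageI[rotated])
    then have "card ?T = card ?S" by (rule bij_betw_same_card[symmetric])
    then show ?thesis by (simp only: jordan_totient2_def)
  qed
  \<comment> \<open>Grouping by \<open>n div gcd\<close> rather than by the gcd makes the divisor \<open>d\<close> itself the index.\<close>
  let ?g = "\<lambda>p. n div gcd (gcd (fst p) (snd p)) n"
  have "(\<Sum>k\<in>{0..<int n}. \<Sum>l\<in>{0..<int n}. H (nat (gcd (gcd k l) (int n))))
      = (\<Sum>p\<in>{1..n} \<times> {1..n}. H (gcd (gcd (fst p) (snd p)) n))"
    by (simp only: shift gcd_mod) (simp only: sum.cartesian_product case_prod_unfold)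
  also have "\<dots> = (\<Sum>p\<in>{1..n} \<times> {1..n}. H (n div ?g p))"
    using n by (intro sum.cong refl) (simp add: div_div_eq_right)
  also have "\<dots> = (\<Sum>d | d dvd n. \<Sum>p | p \<in> {1..n} \<times> {1..n} \<and> ?g p = d. H (n div ?g p))"
  proof (rule sum.group[symmetric])
    show "finite {d. d dvd n}" using n by simp
    show "?g ` ({1..n} \<times> {1..n}) \<subseteq> {d. d dvd n}"
    proof (rule image_subsetI)
      fix p :: "nat \<times> nat"
      have "?g p * gcd (gcd (fst p) (snd p)) n = n" by simp
      then show "?g p \<in> {d. d dvd n}" by (metis dvd_triv_left mem_Collect_eq)
    qed
  qed simp
  also have "\<dots> = (\<Sum>d | d dvd n. \<Sum>p | p \<in> {1..n} \<times> {1..n} \<and> ?g p = d. H (n div d))"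
    by (intro sum.cong refl) auto
  also have "\<dots> = (\<Sum>d | d dvd n. of_nat (jordan_totient2 d) * H (n div d))"
    by (intro sum.cong refl) (simp only: sum_constant count mem_Collect_eq)
  finally show ?thesis .
qed

section \<open>Orbicycles\<close>

text \<open>In an abelian group every class is a singleton and every centralizer is the whole group.\<close>

lemma sum_class_pairs_integer_mod_group:
  assumes n: "n \<ge> 1" and s: "class_reps (integer_mod_group n) s"
  shows "(\<Sum>p\<in>class_pairs (integer_mod_group n) s. of_nat (card (fst p)) * F (s (fst p)) (snd p)) =
         (\<Sum>k\<in>{0..<int n}. \<Sum>l\<in>{0..<int n}. F k l :: 'r::comm_semiring_1)"
proof -
  let ?Z = "integer_mod_group n"
  have C: "carrier ?Z = {0..<int n}" using n by (simp add: carrier_integer_mod_group)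
  define \<gamma> where "\<gamma> = (\<lambda>g. \<lambda>h\<in>carrier ?Z. g \<otimes>\<^bsub>?Z\<^esub> h \<otimes>\<^bsub>?Z\<^esub> inv\<^bsub>?Z\<^esub> g)"
  have "\<gamma> g k = k" if "g \<in> carrier ?Z" "k \<in> carrier ?Z" for g k
    using that by (simp add: \<gamma>_def) (simp add: C mod_simps)
  then have "(\<lambda>g. \<gamma> g k) ` carrier ?Z = {k}" if "k \<in> carrier ?Z" for k
    using that by (auto simp: image_constant_conv)
  then have "orbit ?Z \<gamma> ` carrier ?Z = (\<lambda>k. {k}) ` carrier ?Z"
    by (intro image_cong refl) (simp add: orbit_def Setcompr_eq_image)
  then have cl: "conj_classes ?Z = (\<lambda>k. {k}) ` {0..<int n}"
    unfolding conj_classes_def \<gamma>_def[symmetric] by (simp only: orbits_def Setcompr_eq_image C)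
  then have sk: "s {k} = k" if "k \<in> {0..<int n}" for k
    using s that by (auto simp: class_reps_def)
  have "centralizer ?Z k = {0..<int n}" for k
    by (auto simp: centralizer_def C add.commute)
  then have "class_pairs ?Z s = (\<lambda>k. {k}) ` {0..<int n} \<times> {0..<int n}"
    by (simp add: class_pairs_def cl)
  then have "(\<Sum>p\<in>class_pairs ?Z s. of_nat (card (fst p)) * F (s (fst p)) (snd p))
      = (\<Sum>c\<in>(\<lambda>k. {k}) ` {0..<int n}. \<Sum>l\<in>{0..<int n}. of_nat (card c) * F (s c) l)"
    by (simp add: sum.cartesian_product case_prod_beta)
  also have "\<dots> = (\<Sum>k\<in>{0..<int n}. \<Sum>l\<in>{0..<int n}. F k l)"
    by (subst sum.reindex) (auto simp: sk intro!: sum.cong)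
  finally show ?thesis .
qed

text \<open>Translations permute the coordinates and so preserve the product weight; hence the count for
  orbiquotients applies to the cyclic group, and the summand of a pair of residues depends only on
  its gcd with \<open>n\<close>.\<close>

lemma orbi_cycles_weight:
  fixes w :: "'y \<Rightarrow> 'r::comm_semiring_1"
  assumes n: "n \<ge> 1" and s: "class_reps (integer_mod_group n) s" and Y: "finite Y"
  shows "of_nat n * (\<Sum>z\<in>orbi_cycles s n Y. orbi_weight (tuple_weight n w) z) =
         (\<Sum>d | d dvd n. of_nat (jordan_totient2 d) * (\<Sum>y\<in>Y. w y ^ d) ^ (n div d))"
proof -
  let ?Z = "integer_mod_group n"
  let ?I = "invariants (tuples n Y) (translate n Y)"
  have C: "carrier ?Z = {0..<int n}" using n by (simp add: carrier_integer_mod_group)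
  have inv: "tuple_weight n w (translate n Y k y) = tuple_weight n w y"
    if k: "k \<in> carrier ?Z" and y: "y \<in> tuples n Y" for k y
  proof -
    interpret group ?Z by simp
    have "bij_betw (\<lambda>i. i \<otimes>\<^bsub>?Z\<^esub> k) (carrier ?Z) (carrier ?Z)"
      using k by (intro bij_betw_byWitness[where f' = "\<lambda>i. i \<otimes>\<^bsub>?Z\<^esub> inv\<^bsub>?Z\<^esub> k"])
        (auto simp: m_assoc simp del: mult_integer_mod_group inv_integer_mod_group)
    then have "(\<Prod>i\<in>carrier ?Z. w (y (i \<otimes>\<^bsub>?Z\<^esub> k))) = (\<Prod>i\<in>carrier ?Z. w (y i))"
      by (rule prod.reindex_bij_betw)
    then show ?thesis using y by (simp add: tuple_weight_def translate_def)
  qed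
  have "of_nat (order ?Z) * (\<Sum>z\<in>orbiquotient ?Z s (tuples n Y) (translate n Y).
           orbi_weight (tuple_weight n w) z) =
      (\<Sum>p\<in>class_pairs ?Z s. of_nat (card (fst p)) *
         (\<Sum>y\<in>?I (s (fst p)) \<inter> ?I (snd p). tuple_weight n w y))"
    using Y inv s by (intro orbiquotient_weight translate_group_action[OF n])
      (auto simp: C tuples_def intro!: finite_PiE)
  also have "\<dots> = (\<Sum>k\<in>{0..<int n}. \<Sum>l\<in>{0..<int n}. \<Sum>y\<in>?I k \<inter> ?I l. tuple_weight n w y)"
    by (rule sum_class_pairs_integer_mod_group[OF n s])
  also have "\<dots> = (\<Sum>d | d dvd n. of_nat (jordan_totient2 d) *
      (\<Sum>y\<in>Y. w y ^ (n div (n div d))) ^ (n div d))"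
    by (simp only: fixed_tuples_weight[OF n Y]
      sum_residue_pairs[OF n, of "\<lambda>e. (\<Sum>y\<in>Y. w y ^ (n div e)) ^ e"])
  also have "\<dots> = (\<Sum>d | d dvd n. of_nat (jordan_totient2 d) * (\<Sum>y\<in>Y. w y ^ d) ^ (n div d))"
    using n by (intro sum.cong refl) (auto elim!: dvdE)
  finally show ?thesis by (simp add: orbi_cycles_def order_def C)
qed

lemma eq_unit_inv_mult:
  fixes a b x :: "'r::comm_ring_1"
  assumes "a dvd 1" "a * x = b"
  shows "x = unit_inv a * b"
proof -
  have "unit_inv a * b = (a * unit_inv a) * x" by (simp add: assms(2)[symmetric] ac_simps)
  then show ?thesis by (simp add: unit_inv_right[OF assms(1)])
qed

theorem theorem7:
  fixes G :: "('g, 'm) monoid_scheme"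
    and X :: "'x set"
    and \<phi> :: "'g \<Rightarrow> 'x \<Rightarrow> 'x"
    and f :: "'x \<Rightarrow> 'r::comm_ring_1"
    and n :: nat
    and r :: "'g set \<Rightarrow> 'g"
    and s :: "int set \<Rightarrow> int"
  assumes "finite X"
    and "finite (carrier G)"
    and "group_action G X \<phi>"
    and "\<forall>g\<in>carrier G. \<forall>x\<in>X. f (\<phi> g x) = f x"
    and "class_reps G r"
    and "class_reps (integer_mod_group n) s"
    and "n \<ge> 1"
    and "(of_nat n :: 'r) dvd 1"
    and "(of_nat (order G) :: 'r) dvd 1"
  shows "(\<Sum>z\<in>orbi_cycles s n (orbiquotient G r X \<phi>).
            orbi_weight (tuple_weight n (orbi_weight f)) z) =
         unit_inv (of_nat n) *
         (\<Sum>d | d dvd n. \<Sum>\<alpha>\<in>{1..n div d} \<rightarrow>\<^sub>E class_pairs G r.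
            of_nat (jordan_totient2 d) * unit_inv (of_nat (order G) ^ (n div d)) *
            (\<Prod>i=1..n div d.
               of_nat (card (fst (\<alpha> i))) *
               (\<Sum>x\<in>invariants X \<phi> (r (fst (\<alpha> i))) \<inter> invariants X \<phi> (snd (\<alpha> i)). f x ^ d)))"
proof -
  note X = assms(1) and G = assms(2) and act = assms(3) and f = assms(4) and r = assms(5)
  let ?Y = "orbiquotient G r X \<phi>"
  let ?F = "\<lambda>d p. of_nat (card (fst p)) *
    (\<Sum>x\<in>invariants X \<phi> (r (fst p)) \<inter> invariants X \<phi> (snd p). f x ^ d)"
  have fin_P: "finite (class_pairs G r)"
    using G by (auto simp: class_pairs_def finite_conj_classes finite_centralizer)
  have power: "(\<Sum>z\<in>?Y. orbi_weight f z ^ d) ^ m =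
      (\<Sum>\<alpha>\<in>{1..m} \<rightarrow>\<^sub>E class_pairs G r. unit_inv (of_nat (order G) ^ m) * (\<Prod>i=1..m. ?F d (\<alpha> i)))"
    for d m
  proof -
    have "of_nat (order G) * (\<Sum>z\<in>?Y. orbi_weight f z ^ d) = (\<Sum>p\<in>class_pairs G r. ?F d p)"
      using orbiquotient_weight[OF act G X _ r, of "\<lambda>x. f x ^ d"] f
      by (simp add: orbi_weight_power[OF act f r])
    then have "of_nat (order G) ^ m * (\<Sum>z\<in>?Y. orbi_weight f z ^ d) ^ m
        = (\<Sum>p\<in>class_pairs G r. ?F d p) ^ m"
      by (simp flip: power_mult_distrib)
    also have "\<dots> = (\<Prod>i\<in>{1..m}. \<Sum>p\<in>class_pairs G r. ?F d p)" by simp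
    also have "\<dots> = (\<Sum>\<alpha>\<in>{1..m} \<rightarrow>\<^sub>E class_pairs G r. \<Prod>i\<in>{1..m}. ?F d (\<alpha> i))"
      using fin_P by (intro prod_sum_PiE) auto
    finally have "of_nat (order G) ^ m * (\<Sum>z\<in>?Y. orbi_weight f z ^ d) ^ m
        = (\<Sum>\<alpha>\<in>{1..m} \<rightarrow>\<^sub>E class_pairs G r. \<Prod>i\<in>{1..m}. ?F d (\<alpha> i))" .
    moreover have "(of_nat (order G) ^ m :: 'r) dvd 1"
      using assms(9) by (metis dvd_power_same power_one)
    ultimately have "(\<Sum>z\<in>?Y. orbi_weight f z ^ d) ^ m = unit_inv (of_nat (order G) ^ m) *
        (\<Sum>\<alpha>\<in>{1..m} \<rightarrow>\<^sub>E class_pairs G r. \<Prod>i\<in>{1..m}. ?F d (\<alpha> i))"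
      by (intro eq_unit_inv_mult)
    then show ?thesis by (simp only: sum_distrib_left)
  qed
  have "of_nat n * (\<Sum>z\<in>orbi_cycles s n ?Y. orbi_weight (tuple_weight n (orbi_weight f)) z) =
      (\<Sum>d | d dvd n. of_nat (jordan_totient2 d) * (\<Sum>z\<in>?Y. orbi_weight f z ^ d) ^ (n div d))"
    using orbi_cycles_weight[OF assms(7,6) finite_orbiquotient[OF G X]] by blast
  also have "\<dots> = (\<Sum>d | d dvd n. \<Sum>\<alpha>\<in>{1..n div d} \<rightarrow>\<^sub>E class_pairs G r.
      of_nat (jordan_totient2 d) * unit_inv (of_nat (order G) ^ (n div d)) *
      (\<Prod>i=1..n div d. ?F d (\<alpha> i)))"
    by (simp only: power sum_distrib_left mult.assoc)
  finally show ?thesis by (rule eq_unit_inv_mult[OF assms(8)])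
qed

end
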